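(* For every integer $n\geq 3$, the M\"obius function of the poset $(P\!E_{n},\leq_{\mathrm{dref}})$ satisfies $$\mu_{(P\!E_{n},\leq_{\mathrm{dref}})}(\mathbf{0},\mathbf{1})=(-1)^{n-1}\frac{4}{n}\binom{2n-5}{n-4}.$$
   Context: Write $[n]=\{1,\dots,n\}$. A set partition $\mathbf{x}$ of $[n]$ is noncrossing if for all $1\leq i<j<k<l\leq n$, whenever $i,k$ lie in a common block and $j,l$ lie in a common block, then $i,j$ lie in a common block; write $i\sim_{\mathbf{x}}j$ if $i,j$ lie in the same block. $NC_{n}$ is the set of noncrossing set partitions of $[n]$, and $\leq_{\mathrm{dref}}$ (dual refinement) is defined by $\mathbf{x}\leq_{\mathrm{dref}}\mathbf{y}$ iff every block of $\mathbf{x}$ is contained in a block of $\mathbf{y}$; $\mathbf{0}$ is the partition into singletons and $\mathbf{1}$ is the one-block partition. For $n\geq 3$, $P\!E_{n}$ is the set of all $\mathbf{x}\in NC_{n}$ such that $\{n-1,n\}$ is not a block of $\mathbf{x}$, and it is not the case that both $1\sim_{\mathbf{x}}n-1$ and $\{n\}$ is a block of $\mathbf{x}$. $(P\!E_{n},\leq_{\mathrm{dref}})$ is the induced subposet of $(NC_{n},\leq_{\mathrm{dref}})$ on $P\!E_{n}$. The M\"obius function of a finite poset $\mathcal{L}=(L,\leq)$ is defined by $\mu_{\mathcal{L}}(x,x)=1$, $\mu_{\mathcal{L}}(x,y)=-\sum_{x<z\leq y}\mu_{\mathcal{L}}(z,y)$ if $x<y$, and $\mu_{\mathcal{L}}(x,y)=0$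 otherwise. Binomial coefficients $\binom{a}{b}$ with $b<0$ are $0$ (relevant for $n=3$). *)

theory Defs
  imports Complex_Main "HOL-Library.Disjoint_Sets"
begin

definition finite_poset :: "'a set \<Rightarrow> 'a rel \<Rightarrow> bool" where
  "finite_poset L r \<longleftrightarrow> finite L \<and> partial_order_on L r"

text \<open>
  The poset is given by its carrier \<open>L\<close> and its (non-strict) order relation \<open>r\<close>, so that
  \<open>(x, y) \<in> r\<close> means \<open>x \<le> y\<close>. The guard \<open>finite_poset L r\<close> is what makes the recursion
  terminate; the function is a dummy \<open>0\<close> if \<open>(L, r)\<close> is not a finite poset. Lemmas \<open>mobius_refl\<close>,
  \<open>mobius_less\<close> and \<open>mobius_other\<close> below are the defining equations without the guard.
\<close>

function mobius :: "'a set \<Rightarrow> 'a rel \<Rightarrow> 'a \<Rightarrow> 'a \<Rightarrow> int" where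
  "mobius L r x y =
     (if finite_poset L r \<and> x \<in> L \<and> y \<in> L then
        (if x = y then 1
         else if (x, y) \<in> r then
           - (\<Sum>z\<in>{z \<in> L. (x, z) \<in> r \<and> x \<noteq> z \<and> (z, y) \<in> r}. mobius L r z y)
         else 0)
      else 0)"
  by auto
termination
proof (relation "Wellfounded.measure (\<lambda>(L, r, x, y). card (r `` {x}))", goal_cases)
  case 1
  then show ?case by simp
next
  case (2 L r x y z)
  then have fin: "finite L" and po: "partial_order_on L r" and z: "(x, z) \<in> r" "x \<noteq> z"
    by (auto simp: finite_poset_def)
  note D = partial_order_onD[OF po]
  have "finite (r `` {x})"
    by (rule finite_subset[OF _ fin]) (use D(4) in auto)
  moreover have "r `` {z} \<subseteq> r `` {x}"
    using D(2) z by (auto dest: transD)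
  moreover have "x \<in> r `` {x}"
    using D(1) 2 by (auto simp: refl_on_def)
  moreover have "x \<notin> r `` {z}"
    using D(3) z by (auto dest: antisymD)
  ultimately have "r `` {z} \<subset> r `` {x}" "finite (r `` {x})" by blast+
  then show ?case by (simp add: psubset_card_mono)
qed

declare mobius.simps [simp del]

lemma mobius_refl: "finite_poset L r \<Longrightarrow> x \<in> L \<Longrightarrow> mobius L r x x = 1"
  by (simp add: mobius.simps)

lemma mobius_less:
  assumes "finite_poset L r" "(x, y) \<in> r" "x \<noteq> y"
  shows "mobius L r x y = - (\<Sum>z\<in>{z \<in> L. (x, z) \<in> r \<and> x \<noteq> z \<and> (z, y) \<in> r}. mobius L r z y)"
proof -
  have "x \<in> L" "y \<in> L"
    using assms partial_order_onD(4)[of L r] by (auto simp: finite_poset_def)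
  then show ?thesis using assms by (subst mobius.simps) simp
qed

lemma mobius_other:
  assumes "finite_poset L r" "(x, y) \<notin> r"
  shows "mobius L r x y = 0"
proof -
  have "x \<in> L \<Longrightarrow> (x, x) \<in> r"
    using assms(1) by (auto simp: finite_poset_def dest: partial_order_onD(1) refl_onD)
  then show ?thesis using assms by (subst mobius.simps) auto
qed

definition same_block :: "'a set set \<Rightarrow> 'a \<Rightarrow> 'a \<Rightarrow> bool" where
  "same_block P i j \<longleftrightarrow> (\<exists>B\<in>P. i \<in> B \<and> j \<in> B)"

definition noncrossing :: "nat \<Rightarrow> nat set set \<Rightarrow> bool" where
  "noncrossing n P \<longleftrightarrow>
     (\<forall>i j k l. 1 \<le> i \<and> i < j \<and> j < k \<and> k < l \<and> l \<le> n \<and> same_block P i k \<and> same_block P j l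
        \<longrightarrow> same_block P i j)"

definition NC :: "nat \<Rightarrow> nat set set set" where
  "NC n = {P. partition_on {1..n} P \<and> noncrossing n P}"

text \<open>Only meant for \<open>n \<ge> 3\<close>.\<close>

definition PE :: "nat \<Rightarrow> nat set set set" where
  "PE n = {P \<in> NC n. {n - 1, n} \<notin> P \<and> \<not> (same_block P 1 (n - 1) \<and> {n} \<in> P)}"

text \<open>
  Dual refinement is the library's \<open>refines\<close>: \<open>refines A P Q\<close> says that \<open>P\<close> and \<open>Q\<close> partition \<open>A\<close>
  and every block of \<open>P\<close> is contained in a block of \<open>Q\<close>.
\<close>

definition PE_dref :: "nat \<Rightarrow> nat set set rel" where
  "PE_dref n = relation_of (refines {1..n}) (PE n)"

lemma finite_poset_PE: "finite_poset (PE n) (PE_dref n)"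
proof -
  have part: "partition_on {1..n} P" if "P \<in> PE n" for P
    using that by (simp add: PE_def NC_def)
  have "finite (PE n)"
    by (rule finite_subset[OF _ finitely_many_partition_on[of "{1..n}"]]) (auto dest: part)
  moreover have "partial_order_on (PE n) (PE_dref n)"
    unfolding PE_dref_def
  proof (rule partial_order_on_relation_ofI)
    show "refines {1..n} P P" if "P \<in> PE n" for P
      using refines_refl[OF part[OF that]] .
    show "refines {1..n} P R" if "refines {1..n} P Q" "refines {1..n} Q R" for P Q R
      using refines_trans[OF that] .
    show "P = Q" if "refines {1..n} P Q" "refines {1..n} Q P" for P Q
      using refines_asym[OF that] .
  qed
  ultimately show ?thesis by (simp add: finite_poset_def)
qed

definition singletons_partition :: "nat \<Rightarrow> nat set set" where
  "singletons_partition n = (\<lambda>i. {i}) ` {1..n}"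

definition one_block_partition :: "nat \<Rightarrow> nat set set" where
  "one_block_partition n = {{1..n}}"

lemma singletons_partition_in_PE: "n \<ge> 3 \<Longrightarrow> singletons_partition n \<in> PE n"
  by (auto simp: PE_def NC_def singletons_partition_def noncrossing_def same_block_def
      partition_on_singletons doubleton_eq_iff)

lemma one_block_partition_in_PE:
  assumes "n \<ge> 3"
  shows "one_block_partition n \<in> PE n"
proof -
  have "1 \<in> {1..n}" "1 \<notin> {n - 1, n}" "1 \<notin> {n}" using assms by auto
  then have "{n - 1, n} \<noteq> {1..n}" "{n} \<noteq> {1..n}" by blast+
  then show ?thesis
    using assms by (auto simp: PE_def NC_def one_block_partition_def noncrossing_def same_block_def
        intro!: partition_on_space)
qed

text \<open>
  The lower index is an integer because truncated subtraction on \<open>nat\<close> would give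
  \<open>(2 * 3 - 5) choose (3 - 4) = 1\<close> instead of \<open>0\<close>.
\<close>

definition choose_int :: "nat \<Rightarrow> int \<Rightarrow> nat" where
  "choose_int a b = (if b < 0 then 0 else a choose nat b)"

end

theory Submission
  imports Defs "HOL-Computational_Algebra.Formal_Power_Series"
begin

text \<open>
  The Moebius function \<open>\<mu>(\<zero>, x)\<close> of \<open>PE n\<close> is multiplicative over the blocks of \<open>x\<close>. A block of size
  \<open>m\<close> contributes the signed Catalan number \<open>c m = (-1)\<^sup>m\<^sup>-\<^sup>1 C\<^sub>m\<^sub>-\<^sub>1\<close>, to which one copy of \<open>c (m - 1)\<close>
  is added if the block contains \<open>n - 1\<close> and \<open>n\<close>, and a second copy if it also contains \<open>1\<close>; a block
  containing \<open>1\<close> and \<open>n - 1\<close> but not \<open>n\<close> contributes \<open>0\<close>. To see that these products sum to \<open>0\<close> over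
  all \<open>x \<le> z\<close> for \<open>z \<noteq> \<zero>\<close>, choose a block of \<open>z\<close> with minimum \<open>a\<close> and maximum \<open>b \<noteq> a\<close> and group the
  \<open>x\<close> by the result of merging the blocks of \<open>a\<close> and \<open>b\<close>. Each group sums to \<open>0\<close> by the Catalan
  convolution. At the top element the product is \<open>c n + 2 c (n - 1)\<close>.
\<close>

section \<open>Moebius inversion in a finite poset\<close>

text \<open>A left and a right inverse of the zeta function agree. The recursion of
  \<open>mobius\<close> fixes the upper argument, whereas \<open>g\<close> is known through its sums
  over lower sets. Summing \<open>g x * mobius L r z v\<close> over all pairs with x \<le> z in both
  orders yields \<open>mobius L r u v\<close> and \<open>g v\<close>.\<close>

lemma mobius_top_eqI:
  fixes g :: "'a \<Rightarrow> real"
  assumes L: "finite_poset L r" and uv: "u \<in> L" "v \<in> L"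
    and g: "\<And>z. z \<in> L \<Longrightarrow> (\<Sum>x | x \<in> L \<and> (x, z) \<in> r. g x) = of_bool (z = u)"
  shows "real_of_int (mobius L r u v) = g v"
proof -
  have fin: "finite L" and rfl: "\<And>x. x \<in> L \<Longrightarrow> (x, x) \<in> r"
    and trans: "\<And>x y z. (x, y) \<in> r \<Longrightarrow> (y, z) \<in> r \<Longrightarrow> (x, z) \<in> r"
    and asym: "\<And>x y. (x, y) \<in> r \<Longrightarrow> (y, x) \<in> r \<Longrightarrow> x = y"
    using L by (auto simp: finite_poset_def partial_order_on_def preorder_on_def refl_on_def
        dest: transD antisymD)
  have up: "(\<Sum>z | z \<in> L \<and> (x, z) \<in> r. mobius L r z v) = of_bool (x = v)" if x: "x \<in> L" for x
  proof (cases "(x, v) \<in> r")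
    case False
    then have "(z, v) \<notin> r" if "(x, z) \<in> r" for z
      using trans that by blast
    then show ?thesis using False rfl[OF x]
      by (auto intro!: sum.neutral simp: mobius_other[OF L])
  next
    case le: True
    have "{z \<in> L. (x, z) \<in> r} = insert x {z \<in> L. (x, z) \<in> r \<and> x \<noteq> z}"
      using x rfl by auto
    then have "(\<Sum>z | z \<in> L \<and> (x, z) \<in> r. mobius L r z v)
        = mobius L r x v + (\<Sum>z | z \<in> L \<and> (x, z) \<in> r \<and> x \<noteq> z. mobius L r z v)"
      using fin by simp
    also have "(\<Sum>z | z \<in> L \<and> (x, z) \<in> r \<and> x \<noteq> z. mobius L r z v)
        = (\<Sum>z | z \<in> L \<and> (x, z) \<in> r \<and> x \<noteq> z \<and> (z, v) \<in> r. mobius L r z v)"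
      by (rule sum.mono_neutral_right) (use fin in \<open>auto intro: mobius_other[OF L]\<close>)
    also have "mobius L r x v + \<dots> = of_bool (x = v)"
    proof (cases "x = v")
      case True
      then have "{z \<in> L. (x, z) \<in> r \<and> x \<noteq> z \<and> (z, v) \<in> r} = {}"
        using asym by blast
      with True uv show ?thesis by (simp only: mobius_refl[OF L]) simp
    qed (simp add: mobius_less[OF L le])
    finally show ?thesis .
  qed
  have "real_of_int (mobius L r u v) = (\<Sum>z\<in>L. of_bool (z = u) * real_of_int (mobius L r z v))"
    using fin uv by (simp add: of_bool_def if_distrib[of "\<lambda>b. b * _"] cong: if_cong)
  also have "\<dots> = (\<Sum>z\<in>L. \<Sum>x\<in>{x \<in> L. (x, z) \<in> r}. g x * mobius L r z v)"
    by (intro sum.cong refl) (simp only: g[symmetric] sum_distrib_right)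
  also have "\<dots> = (\<Sum>x\<in>L. \<Sum>z\<in>{z \<in> L. (x, z) \<in> r}. g x * mobius L r z v)"
    using fin by (rule sum.swap_restrict) (use fin in auto)
  also have "\<dots> = (\<Sum>x\<in>L. g x * of_int (\<Sum>z | z \<in> L \<and> (x, z) \<in> r. mobius L r z v))"
    by (simp add: sum_distrib_left)
  also have "\<dots> = g v"
    using fin uv by (simp add: up of_bool_def if_distrib[of real_of_int] if_distrib[of "\<lambda>b. _ * b"]
        cong: if_cong)
  finally show ?thesis .
qed

section \<open>Signed Catalan numbers\<close>

text \<open>
  Up to sign the Catalan numbers, shifted by one: \<open>signed_catalan (k + 1) = (-1)\<^sup>k C\<^sub>k\<close>. They are the
  coefficients of \<open>(sqrt (1 + 4 y) - 1) / 2\<close>; the value at \<open>0\<close> lets the recursion start at \<open>1\<close>.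
\<close>

definition signed_catalan :: "nat \<Rightarrow> real" where
  "signed_catalan k = (if k = 0 then 0 else 4 ^ k * ((1/2) gchoose k) / 2)"

lemma signed_catalan_0 [simp]: "signed_catalan 0 = 0"
  by (simp add: signed_catalan_def)

lemma signed_catalan_1 [simp]: "signed_catalan (Suc 0) = 1"
  by (simp add: signed_catalan_def)

lemma signed_catalan_Suc:
  assumes "k \<ge> 1"
  shows "signed_catalan (Suc k) = signed_catalan k * (2 - 4 * real k) / real (Suc k)"
proof -
  have "real (Suc k) * ((1/2) gchoose Suc k) = (1/2 - real k) * ((1/2) gchoose k)"
    using gbinomial_mult_1[of "1/2::real" k] by (simp add: algebra_simps)
  then have "((1/2) gchoose Suc k) = (1/2 - real k) * ((1/2) gchoose k) / real (Suc k)"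
    by (simp add: field_simps)
  then show ?thesis
    using assms by (simp only: signed_catalan_def) (simp add: field_simps)
qed

lemma signed_catalan_2: "signed_catalan 2 = -1"
  using signed_catalan_Suc[of 1] by (simp add: numeral_2_eq_2)

text \<open>The square of sqrt (1 + 4 y) is 1 + 4 y, which has no coefficient of degree
  \<open>m\<close> \<ge> 2. On coefficients this is the Vandermonde identity with both upper
  parameters 1/2.\<close>

lemma signed_catalan_convolution:
  assumes "m \<ge> 2"
  shows "(\<Sum>i=1..m-1. signed_catalan i * signed_catalan (m - i)) = - signed_catalan m"
proof -
  let ?s = "\<lambda>k. 4 ^ k * ((1/2) gchoose k) :: real"
  have "(\<Sum>i=0..m. ?s i * ?s (m - i)) = 4 ^ m * (\<Sum>i=0..m. ((1/2) gchoose i) * ((1/2) gchoose (m - i)))"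
    unfolding sum_distrib_left
    by (intro sum.cong refl) (auto simp: power_add[symmetric])
  also have "\<dots> = 4 ^ m * ((1::real) gchoose m)"
    using gbinomial_Vandermonde[of "1/2::real" "1/2" m] by simp
  also have "(1::real) gchoose m = 0"
    using binomial_gbinomial[of 1 m, where ?'a = real] assms by (simp add: binomial_eq_0)
  finally have "(\<Sum>i=0..m. ?s i * ?s (m - i)) = 0" by simp
  \<comment> \<open>The end terms are split off because \<open>signed_catalan 0\<close> is 0 and not
    half of \<open>?s 0 = 1\<close>; together they contribute \<open>2 * ?s m\<close>.\<close>
  moreover have "{0..m} = insert 0 (insert m {1..m-1})"
    using assms by auto
  ultimately have "2 * ?s m + (\<Sum>i=1..m-1. ?s i * ?s (m - i)) = 0"
    using assms by simp
  moreover have "(\<Sum>i=1..m-1. ?s i * ?s (m - i)) = (\<Sum>i=1..m-1. 4 * (signed_catalan i * signed_catalan (m - i)))"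
    by (intro sum.cong refl) (auto simp: signed_catalan_def)
  moreover have "?s m = 2 * signed_catalan m"
    using assms by (simp add: signed_catalan_def)
  ultimately show ?thesis
    by (simp flip: sum_distrib_left)
qed

text \<open>Both sides have the same ratio of consecutive terms. The induction works with cleared
  denominators and cancels \<open>Suc j * (j + 4)\<close> only at the end.\<close>

lemma signed_catalan_binomial:
  "signed_catalan (j + 3) * real (Suc j) = 2 * (-1) ^ j * real ((2 * j + 3) choose j)"
proof (induction j)
  case 0
  show ?case using signed_catalan_Suc[of 2] signed_catalan_2 by (simp add: eval_nat_numeral)
next
  case (Suc j)
  \<comment> \<open>Two absorption identities: the first lowers both indices, the second only the
    upper one.\<close>
  have *: "((2 * Suc j + 3) choose Suc j) * (Suc j * (j + 4)) = ((2 * j + 3) choose j) * ((2 * j + 5) * (2 * j + 4))"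
  proof -
    have "Suc j * (Suc (2 * j + 4) choose Suc j) = Suc (2 * j + 4) * ((2 * j + 4) choose j)"
      by (rule Suc_times_binomial)
    moreover have "(j + 4) * (Suc (2 * j + 3) choose j) = Suc (2 * j + 3) * ((2 * j + 3) choose j)"
      using binomial_absorb_comp[of "Suc (2 * j + 3)" j] by (simp add: add.commute)
    moreover have "2 * Suc j + 3 = Suc (2 * j + 4)" "2 * j + 4 = Suc (2 * j + 3)" "2 * j + 5 = Suc (2 * j + 4)"
      by simp_all
    ultimately show ?thesis by (metis mult.assoc mult.commute)
  qed
  have **: "real ((2 * Suc j + 3) choose Suc j) * (real (Suc j) * (real j + 4))
      = real ((2 * j + 3) choose j) * ((2 * real j + 5) * (2 * real j + 4))"
    using arg_cong[OF *, of real] by (simp add: algebra_simps)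
  have "signed_catalan (Suc j + 3) * (real j + 4) = - signed_catalan (j + 3) * (4 * real j + 10)"
    using signed_catalan_Suc[of "j + 3"] by (simp add: field_simps)
  then have "signed_catalan (Suc j + 3) * real (Suc (Suc j)) * (real (Suc j) * (real j + 4))
      = - (signed_catalan (j + 3) * real (Suc j)) * ((2 * real j + 5) * (2 * real j + 4))"
    by (simp add: algebra_simps) algebra
  also have "\<dots> = 2 * (-1) ^ Suc j * real ((2 * Suc j + 3) choose Suc j) * (real (Suc j) * (real j + 4))"
    unfolding Suc.IH using ** by (simp add: algebra_simps)
  finally have "signed_catalan (Suc j + 3) * real (Suc (Suc j)) * (real (Suc j) * (real j + 4))
      = 2 * (-1) ^ Suc j * real ((2 * Suc j + 3) choose Suc j) * (real (Suc j) * (real j + 4))" .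
  moreover have "real (Suc j) * (real j + 4) \<noteq> 0"
    by (simp add: add_eq_0_iff)
  ultimately show ?case by (metis mult_right_cancel)
qed

text \<open>The recursion collapses the left side to -2 (n - 3) / n times
  \<open>signed_catalan (n - 1)\<close>. With n = j + 4 the factor n - 3 is the \<open>Suc j\<close>
  of \<open>signed_catalan_binomial\<close>.\<close>

lemma signed_catalan_closed_form:
  assumes "n \<ge> 3"
  shows "signed_catalan n + 2 * signed_catalan (n - 1) = (-1) ^ (n - 1) * (4 / real n) * real (choose_int (2 * n - 5) (int n - 4))"
proof (cases "n = 3")
  \<comment> \<open>The lower index is negative here, so the right side is 0; the left side is 2 + 2
    * (-1).\<close>
  case True
  then show ?thesis using signed_catalan_Suc[of 2] signed_catalan_2 by (simp add: choose_int_def eval_nat_numeral)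
next
  case False
  define j where "j = n - 4"
  have n: "n = j + 4" using False assms by (simp add: j_def)
  have "signed_catalan n = signed_catalan (j + 3) * (2 - 4 * real (j + 3)) / real (j + 4)"
    using signed_catalan_Suc[of "j + 3"] by (simp add: n eval_nat_numeral)
  then have "signed_catalan n + 2 * signed_catalan (n - 1) = - 2 * (signed_catalan (j + 3) * real (Suc j)) / real (j + 4)"
    by (simp add: n field_simps)
  also have "\<dots> = - 4 * (-1) ^ j * real ((2 * j + 3) choose j) / real (j + 4)"
    by (simp only: signed_catalan_binomial)
  also have "\<dots> = (-1) ^ (n - 1) * (4 / real n) * real (choose_int (2 * n - 5) (int n - 4))"
    by (simp add: n choose_int_def power_add add.commute)
  finally show ?thesis .
qed

section \<open>Noncrossing partitions in terms of blocks\<close>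

lemma block_unique:
  assumes "partition_on A P" "B \<in> P" "C \<in> P" "e \<in> B" "e \<in> C"
  shows "B = C"
  using assms by (auto simp: partition_on_def disjoint_def)

lemma partition_on_subset: "partition_on A P \<Longrightarrow> B \<in> P \<Longrightarrow> B \<subseteq> A"
  by (auto simp: partition_on_def)

text \<open>Together with \<open>NC_D\<close> this trades \<open>same_block\<close> for explicit
  blocks. The range conditions disappear because blocks lie in \<open>{1..n}\<close>.\<close>

lemma NC_I:
  assumes "partition_on {1..n} P"
    and "\<And>B C i j k l. B \<in> P \<Longrightarrow> C \<in> P \<Longrightarrow> i \<in> B \<Longrightarrow> k \<in> B \<Longrightarrow> j \<in> C \<Longrightarrow> l \<in> C
      \<Longrightarrow> i < j \<Longrightarrow> j < k \<Longrightarrow> k < l \<Longrightarrow> B = C"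
  shows "P \<in> NC n"
proof -
  have "noncrossing n P"
    unfolding noncrossing_def
  proof (intro allI impI, elim conjE)
    fix i j k l
    assume o: "i < j" "j < k" "k < l" and "same_block P i k" "same_block P j l"
    then obtain B C where "B \<in> P" "i \<in> B" "k \<in> B" "C \<in> P" "j \<in> C" "l \<in> C"
      unfolding same_block_def by blast
    with assms(2)[OF _ _ _ _ _ _ o] show "same_block P i j"
      unfolding same_block_def by blast
  qed
  with assms(1) show ?thesis by (simp add: NC_def)
qed

lemma NC_D:
  assumes P: "P \<in> NC n" and B: "B \<in> P" "i \<in> B" "k \<in> B" and C: "C \<in> P" "j \<in> C" "l \<in> C"
    and "i < j" "j < k" "k < l"
  shows "B = C"
proof -
  have part: "partition_on {1..n} P" and nc: "noncrossing n P" using P by (auto simp: NC_def)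
  have "B \<subseteq> {1..n}" "C \<subseteq> {1..n}" using partition_on_subset[OF part] B(1) C(1) by blast+
  then have "1 \<le> i" "l \<le> n" using B C by auto
  moreover have "same_block P i k" "same_block P j l" using B C by (auto simp: same_block_def)
  ultimately have "same_block P i j" using nc assms(8-10) unfolding noncrossing_def by meson
  then obtain X where "X \<in> P" "i \<in> X" "j \<in> X" unfolding same_block_def by blast
  then show ?thesis
    using block_unique[OF part, of X B i] block_unique[OF part, of X C j] B C by simp
qed

lemma partition_on_merge:
  assumes P: "partition_on A P" and B: "B \<in> P" "C \<in> P"
  shows "partition_on A (insert (B \<union> C) (P - {B, C}))"
proof -
  have dis: "\<Union> P - \<Union> {B, C} = \<Union> (P - {B, C})"
    using P B by (intro diff_Union_pairwise_disjoint) (auto simp: partition_on_def)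
  then have "partition_on (A - (B \<union> C)) (P - {B, C})"
    using P by (auto simp: partition_on_def pairwise_def)
  moreover have "disjnt (B \<union> C) (\<Union> (P - {B, C}))"
    using dis by (auto simp: disjnt_def)
  moreover have "B \<union> C \<subseteq> A" "B \<union> C \<noteq> {}"
    using P B by (auto simp: partition_on_def)
  ultimately show ?thesis
    by (simp add: partition_on_insert)
qed

lemma partition_on_split:
  assumes P: "partition_on A P" and B: "B \<in> P" "B1 \<union> B2 = B" "B1 \<inter> B2 = {}" "B1 \<noteq> {}" "B2 \<noteq> {}"
  shows "partition_on A (insert B1 (insert B2 (P - {B})))"
proof -
  have "\<Union> P - \<Union> {B} = \<Union> (P - {B})"
    using P B(1) by (intro diff_Union_pairwise_disjoint) (auto simp: partition_on_def)
  then have *: "disjnt B (\<Union> (P - {B}))"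
    by (auto simp: disjnt_def)
  have "partition_on (A - B) (P - {B})" "B \<subseteq> A"
    using partition_on_insert[OF *, of A] P B(1) by (auto simp: insert_absorb)
  moreover have "disjnt B2 (\<Union> (P - {B}))" "disjnt B1 (\<Union> (insert B2 (P - {B})))"
    using * B(2,3) by (auto simp: disjnt_iff)
  moreover have "A - B1 - B2 = A - B" "B1 \<subseteq> A" "B2 \<subseteq> A - B1"
    using B \<open>B \<subseteq> A\<close> by auto
  ultimately show ?thesis
    using B(4,5) by (simp add: partition_on_insert)
qed

section \<open>Merging and cutting at the extremal elements of a block\<close>

context
  fixes n :: nat and z :: "nat set set" and D :: "nat set" and a b :: nat
  assumes z: "z \<in> NC n" and D: "D \<in> z" "a \<in> D" "b \<in> D" "\<And>e. e \<in> D \<Longrightarrow> a \<le> e \<and> e \<le> b"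
begin

lemma block_subset:
  assumes "refines {1..n} x z" "B \<in> x" "e \<in> B" "e \<in> D"
  shows "B \<subseteq> D"
proof -
  obtain Y where "Y \<in> z" "B \<subseteq> Y" using assms by (auto simp: refines_def)
  then show ?thesis using block_unique[of "{1..n}" z Y D e] assms D(1) by (auto simp: refines_def)
qed

text \<open>Both blocks lie between \<open>a\<close> and \<open>b\<close>, so f < e would produce
  the crossing a < f < e < b. Hence a single cut recovers \<open>B\<close> and \<open>C\<close> from
  their union.\<close>

lemma extremal_blocks_ordered:
  assumes x: "x \<in> NC n" "refines {1..n} x z" and B: "B \<in> x" "a \<in> B" "C \<in> x" "b \<in> C" "B \<noteq> C"
    and e: "e \<in> B" "f \<in> C"
  shows "e < f"
proof (rule ccontr)
  have part: "partition_on {1..n} x" using x by (simp add: NC_def)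
  have "e \<in> D" "f \<in> D" 
    using block_subset[OF x(2) B(1,2) D(2)] block_subset[OF x(2) B(3,4) D(3)] e by blast+
  then have "a \<le> f" "e \<le> b" using D(4) by blast+
  moreover have "a \<noteq> f" "e \<noteq> b" "e \<noteq> f" 
    using block_unique[OF part B(1,3)] B(2,4,5) e by auto
  moreover assume "\<not> e < f"
  ultimately have "a < f" "f < e" "e < b" by auto
  then show False using NC_D[OF x(1) B(1,2) e(1) B(3) e(2) B(4)] B by simp
qed

text \<open>A block crossing \<open>B \<union> C\<close> must lie in \<open>D\<close>, hence
  strictly between \<open>a\<close> and \<open>b\<close>. Using \<open>a\<close> or \<open>b\<close>
  as an end point, the crossing becomes one with \<open>B\<close> or with \<open>C\<close> alone,
  which \<open>x\<close> excludes.\<close>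

lemma merge_extremal_blocks:
  assumes x: "x \<in> NC n" "refines {1..n} x z" and B: "B \<in> x" "a \<in> B" "C \<in> x" "b \<in> C" "B \<noteq> C"
  shows "insert (B \<union> C) (x - {B, C}) \<in> NC n"
    and "refines {1..n} (insert (B \<union> C) (x - {B, C})) z"
proof -
  let ?y = "insert (B \<union> C) (x - {B, C})"
  have part: "partition_on {1..n} x" using x by (simp add: NC_def)
  have party: "partition_on {1..n} ?y" using partition_on_merge[OF part] B by blast
  have sub: "B \<subseteq> D" "C \<subseteq> D" using block_subset[OF x(2) B(1,2) D(2)] block_subset[OF x(2) B(3,4) D(3)] by simp_all
  show "refines {1..n} ?y z"
    using party x(2) sub D(1) by (auto simp: refines_def)
  have lt: "\<And>e f. e \<in> B \<Longrightarrow> f \<in> C \<Longrightarrow> e < f"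
    using extremal_blocks_ordered[OF x B] .
  have interior: "\<forall>e\<in>E. a < e \<and> e < b"
    if E: "E \<in> x" "E \<noteq> B" "E \<noteq> C" and ij: "e \<in> E" "f \<in> E" "g \<in> B \<union> C" "h \<in> B \<union> C"
      "e < g \<and> g < f \<and> f < h \<or> g < e \<and> e < h \<and> h < f" for E e f g h
  proof -
    obtain Y where Y: "Y \<in> z" "E \<subseteq> Y" using E x by (auto simp: refines_def)
    have gh: "g \<in> D" "h \<in> D" "e \<in> Y" "f \<in> Y" using ij sub Y by auto
    \<comment> \<open>Otherwise the same four points would be a crossing of \<open>Y\<close> and
      \<open>D\<close> in \<open>z\<close>.\<close>
    have "Y = D"
      using ij(5) NC_D[OF z Y(1) gh(3,4) D(1) gh(1,2)] NC_D[OF z D(1) gh(1,2) Y(1) gh(3,4)] by argo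
    then have ED: "E \<subseteq> D" using Y by simp
    have ab: "a \<notin> E" "b \<notin> E"
      using block_unique[OF part E(1) B(1) _ B(2)] block_unique[OF part E(1) B(3) _ B(4)] E(2,3) by argo+
    have "a < e \<and> e < b" if "e \<in> E" for e
      using D(4)[of e] ED ab that by (auto simp: order_le_less)
    then show ?thesis by blast
  qed
  have nc: False
    if E: "E \<in> x" "E \<noteq> B" "E \<noteq> C" and ij: "e \<in> E" "f \<in> E" "g \<in> B \<union> C" "h \<in> B \<union> C"
      "e < g \<and> g < f \<and> f < h \<or> g < e \<and> e < h \<and> h < f" for E e f g h
  proof -
    note nE = NC_D[OF x(1)]
    have k: "a < e" "e < b" "a < f" "f < b" using interior[OF E ij] ij by auto
    consider "g \<in> B" "h \<in> B" | "g \<in> C" "h \<in> C" | "g \<in> B" "h \<in> C" | "g \<in> C" "h \<in> B" using ij by blast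
    then show False
    proof cases
      case 1
      show ?thesis using ij(5) nE[OF E(1) ij(1,2) B(1) 1] nE[OF B(1) 1 E(1) ij(1,2)] E by argo
    next
      case 2
      show ?thesis using ij(5) nE[OF E(1) ij(1,2) B(3) 2] nE[OF B(3) 2 E(1) ij(1,2)] E by argo
    next
      case 3
      \<comment> \<open>The crossing is a < e < g < f with \<open>B\<close> in one order and e < h <
        f < b with \<open>C\<close> in the other.\<close>
      have "E = B" if "e < g" "g < f" using nE[OF B(1,2) 3(1) E(1) ij(1,2)] k that by simp
      moreover have "E = C" if "e < h" "h < f" using nE[OF E(1) ij(1,2) B(3) 3(2) B(4)] k that by simp
      ultimately show ?thesis using ij(5) E by argo
    next
      case 4
      show ?thesis using lt[OF 4(2,1)] ij(5) by linarith
    qed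
  qed
  show "?y \<in> NC n"
  proof (rule NC_I[OF party])
    fix E F i j k l
    assume a: "E \<in> ?y" "F \<in> ?y" and m: "i \<in> E" "k \<in> E" "j \<in> F" "l \<in> F" and o: "i < j" "j < k" "k < l"
    show "E = F"
    proof (cases "E = B \<union> C"; cases "F = B \<union> C")
      assume "E \<noteq> B \<union> C" "F \<noteq> B \<union> C"
      then have "E \<in> x" "F \<in> x" using a by simp_all
      then show ?thesis by (rule NC_D[OF x(1) _ m(1,2) _ m(3,4) o])
    next
      assume h: "E \<noteq> B \<union> C" "F = B \<union> C"
      then have "E \<in> x" "E \<noteq> B" "E \<noteq> C" using a by simp_all
      from nc[OF this m(1,2) m(3,4)[unfolded h(2)]] o show ?thesis by simp
    next
      assume h: "E = B \<union> C" "F \<noteq> B \<union> C"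
      then have "F \<in> x" "F \<noteq> B" "F \<noteq> C" using a by simp_all
      from nc[OF this m(3,4) m(1,2)[unfolded h(1)]] o show ?thesis by simp
    qed simp
  qed
qed

text \<open>A crossing of a piece with another block is already a crossing of \<open>E\<close>, and
  the two pieces are separated by \<open>t\<close>. The elements \<open>s\<close> and
  \<open>u\<close> witness that both are nonempty.\<close>

lemma split_block:
  assumes y: "y \<in> NC n" "refines {1..n} y z" and E: "E \<in> y" "s \<in> E" "s \<le> t" "u \<in> E" "t < u"
  shows "insert {e\<in>E. e \<le> t} (insert {e\<in>E. t < e} (y - {E})) \<in> NC n" (is "?x \<in> _")
    and "refines {1..n} (insert {e\<in>E. e \<le> t} (insert {e\<in>E. t < e} (y - {E}))) z"
proof -
  have part: "partition_on {1..n} y" using y by (simp add: NC_def)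
  have partx: "partition_on {1..n} ?x"
    by (rule partition_on_split[OF part E(1)]) (use E in auto)
  obtain Y where "Y \<in> z" "E \<subseteq> Y" using y(2) E(1) by (auto simp: refines_def)
  then show "refines {1..n} ?x z"
    using partx y(2) by (auto simp: refines_def)
  show "?x \<in> NC n"
  proof (rule NC_I[OF partx])
    fix F G i j k l
    assume a: "F \<in> ?x" "G \<in> ?x" and m: "i \<in> F" "k \<in> F" "j \<in> G" "l \<in> G" and o: "i < j" "j < k" "k < l"
    let ?S = "{{e\<in>E. e \<le> t}, {e\<in>E. t < e}}"
    have "F \<in> ?S \<or> F \<in> y \<and> F \<noteq> E" "G \<in> ?S \<or> G \<in> y \<and> G \<noteq> E" using a by simp_all
    then consider "F \<in> ?S" "G \<in> ?S" | "F \<in> ?S" "G \<in> y" "G \<noteq> E" | "F \<in> y" "F \<noteq> E" "G \<in> ?S"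
      | "F \<in> y" "G \<in> y" by argo
    then show "F = G"
    proof cases
      case 1
      then show ?thesis using m o by auto
    next
      case 2
      then have "i \<in> E" "k \<in> E" using m by auto
      from NC_D[OF y(1) E(1) this 2(2) m(3,4) o] 2(3) show ?thesis by simp
    next
      case 3
      then have "j \<in> E" "l \<in> E" using m by auto
      from NC_D[OF y(1) 3(1) m(1,2) E(1) this o] 3(2) show ?thesis by simp
    next
      case 4
      show ?thesis by (rule NC_D[OF y(1) 4(1) m(1,2) 4(2) m(3,4) o])
    qed
  qed
qed

text \<open>
  Merging the blocks of \<open>a\<close> and \<open>b\<close> groups the refinements of \<open>z\<close>. The group of a partition in
  which \<open>a\<close> and \<open>b\<close> share a block \<open>E\<close> consists of that partition and of those obtained by cutting
  \<open>E\<close> at some \<open>t\<close>, and the hypothesis on \<open>w\<close> makes the sum over each group vanish.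
\<close>

lemma sum_refinements_eq_0:
  fixes w :: "nat set \<Rightarrow> 'b::comm_ring_1"
  assumes ab: "a < b"
    and w: "\<And>E. E \<subseteq> D \<Longrightarrow> a \<in> E \<Longrightarrow> b \<in> E \<Longrightarrow>
      w E + (\<Sum>t\<in>E - {b}. w {e\<in>E. e \<le> t} * w {e\<in>E. t < e}) = 0"
  shows "(\<Sum>x | x \<in> NC n \<and> refines {1..n} x z. \<Prod>B\<in>x. w B) = 0"
proof -
  define X where "X = {x. x \<in> NC n \<and> refines {1..n} x z}"
  define blk where "blk = (\<lambda>x e. THE B. B \<in> x \<and> e \<in> (B :: nat set))"
  define Y where "Y = {x \<in> X. blk x a = blk x b}"
  define W where "W = (\<lambda>x. \<Prod>B\<in>x. w B)"
  define merge where "merge = (\<lambda>x. insert (blk x a \<union> blk x b) (x - {blk x a, blk x b}))"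
  define split where "split = (\<lambda>y t. insert {e\<in>blk y a. e \<le> t} (insert {e\<in>blk y a. t < e} (y - {blk y a})))"
  have part: "partition_on {1..n} x" if "x \<in> X" for x
    using that by (simp add: X_def NC_def)
  have finX: "finite X"
    by (rule finite_subset[OF _ finitely_many_partition_on[of "{1..n}"]]) (use part in auto)
  have finx: "finite x" if "x \<in> X" for x
    using finite_elements[OF _ part[OF that]] by simp
  have blk_eq: "blk x e = B" if "x \<in> X" "B \<in> x" "e \<in> B" for x e B
    unfolding blk_def
  proof (rule the_equality)
    show "C = B" if "C \<in> x \<and> e \<in> C" for C
      using block_unique[OF part[OF \<open>x \<in> X\<close>], of C B e] that \<open>B \<in> x\<close> \<open>e \<in> B\<close> by simp
  qed (use that in simp)
  have "D \<subseteq> {1..n}"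
    using z D(1) by (auto simp: NC_def dest: partition_on_subset)
  have blkD: "blk x e \<in> x \<and> e \<in> blk x e \<and> blk x e \<subseteq> D" if xe: "x \<in> X" "e \<in> D" for x e
  proof -
    obtain B where B: "B \<in> x" "e \<in> B"
      using part[OF xe(1)] xe(2) \<open>D \<subseteq> {1..n}\<close> by (auto simp: partition_on_def)
    then show ?thesis
      using blk_eq[OF xe(1) B] block_subset[of x B e] xe by (simp add: X_def)
  qed
  have fin: "finite B" if "B \<subseteq> D" for B
    using finite_subset[OF that] \<open>D \<subseteq> {1..n}\<close> finite_subset by blast
  have merge: "merge x \<in> Y \<and> Max (blk x a) \<in> blk (merge x) a - {b} \<and> split (merge x) (Max (blk x a)) = x"
    if "x \<in> X - Y" for x
  proof -
    define B C where "B = blk x a" and "C = blk x b"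
    have x: "x \<in> X" "x \<in> NC n" "refines {1..n} x z" and ne: "B \<noteq> C"
      using that by (auto simp: X_def Y_def B_def C_def)
    have B: "B \<in> x" "a \<in> B" "B \<subseteq> D" and C: "C \<in> x" "b \<in> C" "C \<subseteq> D"
      using blkD[OF x(1)] D(2,3) by (auto simp: B_def C_def)
    have m: "merge x = insert (B \<union> C) (x - {B, C})"
      by (simp add: merge_def B_def C_def)
    have lt: "e < f" if "e \<in> B" "f \<in> C" for e f
      using extremal_blocks_ordered[OF x(2,3) B(1,2) C(1,2) ne that] .
    have mX: "merge x \<in> X"
      using merge_extremal_blocks[OF x(2,3) B(1,2) C(1,2) ne] by (simp add: X_def m)
    have blkm: "blk (merge x) a = B \<union> C" "blk (merge x) b = B \<union> C"
      using blk_eq[OF mX, of "B \<union> C"] B C by (auto simp: m)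
    have Max: "Max B \<in> B" "\<And>e. e \<in> B \<Longrightarrow> e \<le> Max B"
      using fin[OF B(3)] B(2) Max_in by auto
    have "{e \<in> B \<union> C. e \<le> Max B} = B" "{e \<in> B \<union> C. Max B < e} = C"
      using Max lt by (auto dest: leD)
    moreover have "B \<union> C \<notin> x"
      using block_unique[OF part[OF x(1)] _ B(1), of "B \<union> C" a]
        block_unique[OF part[OF x(1)] _ C(1), of "B \<union> C" b] B C ne by auto
    ultimately have "split (merge x) (Max B) = x"
      unfolding split_def blkm by (auto simp: m B C)
    moreover have "Max B \<noteq> b"
      using lt[OF Max(1) C(2)] by simp
    ultimately show ?thesis
      using mX blkm Max by (auto simp: Y_def simp flip: B_def)
  qed
  \<comment> \<open>Taking \<open>t\<close> in the block makes it the maximum of the lower piece, so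
    different cut points give different partitions; excluding \<open>b\<close> keeps the upper piece
    nonempty.\<close>
  have split: "split y t \<in> X - Y \<and> merge (split y t) = y \<and> Max (blk (split y t) a) = t
      \<and> W (split y t) = w {e\<in>blk y a. e \<le> t} * w {e\<in>blk y a. t < e} * W (y - {blk y a})"
    if "y \<in> Y" "t \<in> blk y a - {b}" for y t
  proof -
    define E where "E = blk y a"
    define lo hi where "lo = {e\<in>E. e \<le> t}" and "hi = {e\<in>E. t < e}"
    have y: "y \<in> X" "y \<in> NC n" "refines {1..n} y z"
      using that by (auto simp: Y_def X_def)
    have E: "E \<in> y" "a \<in> E" "b \<in> E" "E \<subseteq> D"
      using that(1) blkD[OF y(1)] D(2,3) by (auto simp: Y_def E_def)
    have t: "t \<in> E" "a \<le> t" "t < b"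
      using that(2) E D(4) by (auto simp: E_def order_le_less)
    have s: "split y t = insert lo (insert hi (y - {E}))"
      by (simp add: split_def lo_def hi_def E_def)
    have sX: "split y t \<in> X"
      using split_block[OF y(2,3) E(1) E(2) t(2) E(3) t(3)] by (simp add: X_def s lo_def hi_def)
    have mem: "a \<in> lo" "b \<in> hi" "b \<notin> lo" "a \<notin> hi" "t \<in> lo" "lo \<union> hi = E"
      using E t by (auto simp: lo_def hi_def)
    have blks: "blk (split y t) a = lo" "blk (split y t) b = hi"
      using blk_eq[OF sX, of lo a] blk_eq[OF sX, of hi b] mem by (auto simp: s)
    \<comment> \<open>The pieces are new and distinct, so the product over the set of blocks gains
      exactly the two factors \<open>w lo\<close> and \<open>w hi\<close>.\<close>
    have nin: "lo \<notin> y" "hi \<notin> y" "lo \<noteq> hi"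
      using block_unique[OF part[OF y(1)] _ E(1), of lo a]
        block_unique[OF part[OF y(1)] _ E(1), of hi b] mem E by auto
    have "merge (split y t) = y"
      unfolding merge_def blks using nin E mem(6) by (auto simp: s)
    moreover have "Max lo = t"
      by (rule Max_eqI) (use fin[OF E(4)] mem in \<open>auto simp: lo_def\<close>)
    moreover have "W (split y t) = w lo * w hi * W (y - {E})"
      unfolding W_def s using nin finx[OF y(1)] by (simp add: mult.assoc)
    ultimately show ?thesis
      using sX blks nin(3) by (simp add: Y_def lo_def hi_def E_def)
  qed
  have "(\<Sum>x\<in>X - Y. W x) = (\<Sum>(y, t)\<in>Sigma Y (\<lambda>y. blk y a - {b}). W (split y t))"
    by (rule sum.reindex_bij_witness[where i = "\<lambda>(y, t). split y t" and j = "\<lambda>x. (merge x, Max (blk x a))"])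
      (use merge split in auto)
  also have "\<dots> = (\<Sum>y\<in>Y. \<Sum>t\<in>blk y a - {b}. W (split y t))"
  proof (rule sum.Sigma[symmetric])
    show "finite Y" using finX by (simp add: Y_def)
    have "Y \<subseteq> X" by (auto simp: Y_def)
    have "finite (blk y a)" if "y \<in> Y" for y
      using blkD[OF _ D(2)] that \<open>Y \<subseteq> X\<close> by (intro fin) blast
    then show "\<forall>y\<in>Y. finite (blk y a - {b})" by simp
  qed
  finally have XY: "(\<Sum>x\<in>X - Y. W x) = (\<Sum>y\<in>Y. \<Sum>t\<in>blk y a - {b}. W (split y t))" .
  have "(\<Sum>x\<in>X. W x) = (\<Sum>x\<in>X - Y. W x) + (\<Sum>y\<in>Y. W y)"
    by (rule sum.subset_diff) (use finX in \<open>auto simp: Y_def\<close>)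
  also have "\<dots> = (\<Sum>y\<in>Y. (\<Sum>t\<in>blk y a - {b}. W (split y t)) + W y)"
    by (simp add: XY sum.distrib)
  also have "\<dots> = 0"
  proof (rule sum.neutral, rule ballI)
    fix y assume y: "y \<in> Y"
    define E where "E = blk y a"
    have E: "E \<in> y" "a \<in> E" "b \<in> E" "E \<subseteq> D" and yX: "y \<in> X"
      using y blkD[of y] D(2,3) by (auto simp: Y_def E_def)
    \<comment> \<open>Every member of the group of \<open>y\<close> shares the factor
      \<open>W (y - {E})\<close>; what remains is the expression in the hypothesis on
      \<open>w\<close>.\<close>
    have "W y = w E * W (y - {E})"
      unfolding W_def using finx[OF yX] E(1) by (rule prod.remove)
    moreover have "(\<Sum>t\<in>E - {b}. W (split y t))
        = (\<Sum>t\<in>E - {b}. w {e\<in>E. e \<le> t} * w {e\<in>E. t < e}) * W (y - {E})"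
      using split[OF y] by (simp add: sum_distrib_right E_def)
    ultimately have "(\<Sum>t\<in>E - {b}. W (split y t)) + W y
        = (w E + (\<Sum>t\<in>E - {b}. w {e\<in>E. e \<le> t} * w {e\<in>E. t < e})) * W (y - {E})"
      by (simp add: algebra_simps)
    then show "(\<Sum>t\<in>blk y a - {b}. W (split y t)) + W y = 0"
      using w[OF E(4,2,3)] by (simp add: E_def)
  qed
  finally show ?thesis by (simp add: X_def W_def)
qed

end

section \<open>Cancellation of the weights within a block\<close>

text \<open>The rank of \<open>t\<close> in \<open>E\<close> is strictly increasing, hence a
  bijection from \<open>E - {b}\<close> onto \<open>{1..card E - 1}\<close> by counting.\<close>

lemma sum_initial_segments:
  fixes E :: "nat set" and F :: "nat \<Rightarrow> nat \<Rightarrow> 'b::comm_monoid_add"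
  assumes E: "finite E" "b \<in> E" "\<And>e. e \<in> E \<Longrightarrow> e \<le> b"
  shows "(\<Sum>t\<in>E - {b}. F (card {e\<in>E. e \<le> t}) (card {e\<in>E. t < e})) = (\<Sum>i=1..card E - 1. F i (card E - i))"
proof -
  let ?h = "\<lambda>t. card {e\<in>E. e \<le> t}"
  have "strict_mono_on (E - {b}) ?h"
  proof (rule strict_mono_onI, rule psubset_card_mono)
    fix r s assume "r < s" "s \<in> E - {b}"
    then have "s \<in> {e\<in>E. e \<le> s}" "s \<notin> {e\<in>E. e \<le> r}" "{e\<in>E. e \<le> r} \<subseteq> {e\<in>E. e \<le> s}" by auto
    then show "{e\<in>E. e \<le> r} \<subset> {e\<in>E. e \<le> s}" by blast
  qed (use E in simp)
  then have inj: "inj_on ?h (E - {b})"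
    by (rule strict_mono_on_imp_inj_on)
  have "?h ` (E - {b}) \<subseteq> {1..card E - 1}"
  proof (rule image_subsetI)
    fix t assume t: "t \<in> E - {b}"
    then have "{e\<in>E. e \<le> t} \<subseteq> E - {b}" "t \<in> {e\<in>E. e \<le> t}"
      using E(3)[of t] by auto
    then have "?h t \<le> card (E - {b})" "0 < ?h t"
      using E(1) by (auto intro: card_mono simp: card_gt_0_iff)
    then show "?h t \<in> {1..card E - 1}"
      unfolding atLeastAtMost_iff card_Diff_singleton[OF E(2)] by linarith
  qed
  then have "?h ` (E - {b}) = {1..card E - 1}"
    using inj E by (intro card_subset_eq) (simp_all add: card_image)
  then have "bij_betw ?h (E - {b}) {1..card E - 1}"
    using inj by (simp only: bij_betw_def)
  from sum.reindex_bij_betw[OF this, of "\<lambda>i. F i (card E - i)"]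
  have "(\<Sum>i=1..card E - 1. F i (card E - i)) = (\<Sum>t\<in>E - {b}. F (?h t) (card E - ?h t))" by simp
  also have "\<dots> = (\<Sum>t\<in>E - {b}. F (?h t) (card {e\<in>E. t < e}))"
  proof (intro sum.cong refl)
    fix t assume "t \<in> E - {b}"
    have "{e\<in>E. t < e} = E - {e\<in>E. e \<le> t}" by auto
    then have "card {e\<in>E. t < e} = card E - ?h t"
      using E(1) by (simp add: card_Diff_subset)
    then show "F (?h t) (card E - ?h t) = F (?h t) (card {e\<in>E. t < e})" by simp
  qed
  finally show ?thesis by simp
qed

definition PE_weight :: "nat \<Rightarrow> nat set \<Rightarrow> real" where
  "PE_weight n B =
     (if n - 1 \<notin> B then signed_catalan (card B)
      else if n \<in> B then signed_catalan (card B) + (if 1 \<in> B then 2 else 1) * signed_catalan (card B - 1)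
      else if 1 \<in> B then 0 else signed_catalan (card B))"

text \<open>
  The product of these weights is the Moebius function \<open>\<mu>(\<zero>, x)\<close> of \<open>PE n\<close>, extended by \<open>0\<close> to
  \<open>NC n\<close>. They arise from the Moebius function of \<open>NC n\<close>, whose weights are
  \<^term>\<open>signed_catalan (card B)\<close>, on removing the intervals of the partitions with block \<open>{n - 1, n}\<close>
  and of those with \<open>1 \<sim> n - 1\<close> and block \<open>{n}\<close>.
\<close>

lemma PE_weight_cancel:
  assumes n: "n \<ge> 3" and E: "E \<subseteq> {1..n}" "a \<in> E" "b \<in> E" "\<And>e. e \<in> E \<Longrightarrow> a \<le> e \<and> e \<le> b" "a < b"
    and PE: "E \<noteq> {n - 1, n}" "\<not> (1 \<in> E \<and> n - 1 \<in> E \<and> n \<notin> E)"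
  shows "PE_weight n E + (\<Sum>t\<in>E - {b}. PE_weight n {e\<in>E. e \<le> t} * PE_weight n {e\<in>E. t < e}) = 0"
proof -
  let ?c = signed_catalan and ?m = "card E"
  have fin: "finite E" using E(1) finite_subset by blast
  note segments = sum_initial_segments[OF fin E(3)]
  have "card {a, b} \<le> ?m" using E fin by (intro card_mono) auto
  then have m: "?m \<ge> 2" using E(5) by simp
  show ?thesis
  proof (cases "n - 1 \<in> E \<and> n \<in> E")
    case False
    have *: "PE_weight n S = ?c (card S)" if "S \<subseteq> E" for S
      using that False PE(2) by (auto simp: PE_weight_def)
    have "(\<Sum>t\<in>E - {b}. PE_weight n {e\<in>E. e \<le> t} * PE_weight n {e\<in>E. t < e})
        = (\<Sum>t\<in>E - {b}. ?c (card {e\<in>E. e \<le> t}) * ?c (card {e\<in>E. t < e}))"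
      by (intro sum.cong refl arg_cong2[of _ _ _ _ "(*)"] *) auto
    also have "\<dots> = - ?c ?m"
      using segments[of "\<lambda>i j. ?c i * ?c j"] E(4) signed_catalan_convolution[OF m] by simp
    finally show ?thesis by (simp add: *)
  next
    case True
    then have b: "b = n" using E(1,3) E(4)[of n] by fastforce
    \<comment> \<open>The convolution for \<open>?m - 1\<close> requires \<open>?m - 1\<close> \<ge>
      2; this is where the excluded block \<open>{n - 1, n}\<close> matters.\<close>
    have "?m \<noteq> 2"
    proof
      assume "?m = 2"
      then have "{n - 1, n} = E" using True fin n by (intro card_subset_eq) auto
      then show False using PE(1) by simp
    qed
    then have m3: "?m \<ge> 3" using m by simp
    \<comment> \<open>For t < n - 1 the upper piece contains n - 1 and n but not 1. At t = n - 1 it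
      is \<open>{n}\<close>, where the general formula still holds since
      \<open>signed_catalan 0 = 0\<close>; but the lower piece \<open>E - {n}\<close> has weight 0
      if it contains 1, hence the correction.\<close>
    have *: "PE_weight n {e\<in>E. e \<le> t} * PE_weight n {e\<in>E. t < e}
        = ?c (card {e\<in>E. e \<le> t}) * (?c (card {e\<in>E. t < e}) + ?c (card {e\<in>E. t < e} - 1))
          - (if t = n - 1 \<and> 1 \<in> E then ?c (?m - 1) else 0)" if t: "t \<in> E - {b}" for t
    proof (cases "t = n - 1")
      case False
      have "1 \<le> t" "t \<le> n" "t \<noteq> n" using t E(1) b by auto
      then have "1 \<le> t" "t < n - 1" using False by auto
      then show ?thesis using True n by (auto simp: PE_weight_def)
    next
      case t': True
      have "{e\<in>E. e \<le> t} = E - {n}" "{e\<in>E. t < e} = {n}" using E(1) t' n True by force+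
      then show ?thesis using True n fin t' by (auto simp: PE_weight_def)
    qed
    have "(\<Sum>t\<in>E - {b}. if t = n - 1 \<and> 1 \<in> E then ?c (?m - 1) else 0)
        = (\<Sum>t\<in>E - {b}. if t = n - 1 then (if 1 \<in> E then ?c (?m - 1) else 0) else 0)"
      by (intro sum.cong refl) auto
    also have "\<dots> = (if 1 \<in> E then ?c (?m - 1) else 0)"
      using fin True b n by simp
    finally have corr: "(\<Sum>t\<in>E - {b}. if t = n - 1 \<and> 1 \<in> E then ?c (?m - 1) else 0)
        = (if 1 \<in> E then ?c (?m - 1) else 0)" .
    have "(\<Sum>t\<in>E - {b}. PE_weight n {e\<in>E. e \<le> t} * PE_weight n {e\<in>E. t < e})
        = (\<Sum>t\<in>E - {b}. ?c (card {e\<in>E. e \<le> t}) * (?c (card {e\<in>E. t < e}) + ?c (card {e\<in>E. t < e} - 1)))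
          - (if 1 \<in> E then ?c (?m - 1) else 0)"
      by (simp only: sum.cong[OF refl *] sum_subtractf corr)
    also have "(\<Sum>t\<in>E - {b}. ?c (card {e\<in>E. e \<le> t}) * (?c (card {e\<in>E. t < e}) + ?c (card {e\<in>E. t < e} - 1)))
        = (\<Sum>i=1..?m - 1. ?c i * (?c (?m - i) + ?c (?m - i - 1)))"
      using segments[of "\<lambda>i j. ?c i * (?c j + ?c (j - 1))"] E(4) by simp
    also have "\<dots> = (\<Sum>i=1..?m - 1. ?c i * ?c (?m - i)) + (\<Sum>i=1..?m - 1. ?c i * ?c (?m - 1 - i))"
      by (simp add: distrib_left sum.distrib diff_commute)
    \<comment> \<open>The last summand contains \<open>signed_catalan 0\<close>.\<close>
    also have "(\<Sum>i=1..?m - 1. ?c i * ?c (?m - 1 - i)) = (\<Sum>i=1..?m - 1 - 1. ?c i * ?c (?m - 1 - i))"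
    proof (rule sum.mono_neutral_right)
      show "\<forall>i\<in>{1..?m - 1} - {1..?m - 1 - 1}. ?c i * ?c (?m - 1 - i) = 0"
      proof
        fix i assume "i \<in> {1..?m - 1} - {1..?m - 1 - 1}"
        then have "?m - 1 - i = 0" by auto
        then show "?c i * ?c (?m - 1 - i) = 0" by simp
      qed
    qed auto
    also have "\<dots> = - ?c (?m - 1)"
      by (rule signed_catalan_convolution) (use m3 in simp)
    also have "(\<Sum>i=1..?m - 1. ?c i * ?c (?m - i)) = - ?c ?m"
      by (rule signed_catalan_convolution[OF m])
    finally show ?thesis using True by (simp add: PE_weight_def)
  qed
qed

section \<open>Lower sums of the weights over the poset\<close>

text \<open>Each forbidden pattern forces a block of weight 0. Sums over \<open>PE n\<close> thus
  extend to \<open>NC n\<close>, which is closed under cutting; \<open>PE n\<close> is not, as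
  cutting \<open>{1..n}\<close> at n - 2 creates \<open>{n - 1, n}\<close>.\<close>

lemma prod_PE_weight_eq_0:
  assumes n: "n \<ge> 3" and x: "x \<in> NC n" "x \<notin> PE n"
  shows "(\<Prod>B\<in>x. PE_weight n B) = 0"
proof -
  have part: "partition_on {1..n} x" using x by (simp add: NC_def)
  then have fin: "finite x" using finite_elements[OF _ part] by simp
  have "\<exists>B\<in>x. PE_weight n B = 0"
  proof (cases "{n - 1, n} \<in> x")
    case True
    have "card {n - 1, n} = 2" "1 \<notin> {n - 1, n}" using n by auto
    then have "PE_weight n {n - 1, n} = signed_catalan 2 + signed_catalan (2 - 1)"
      by (simp only: PE_weight_def) simp
    then have "PE_weight n {n - 1, n} = 0"
      by (simp add: signed_catalan_2)
    with True show ?thesis by blast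
  next
    case False
    then have "same_block x 1 (n - 1)" "{n} \<in> x" using x by (auto simp: PE_def)
    then obtain B where B: "B \<in> x" "1 \<in> B" "n - 1 \<in> B" by (auto simp: same_block_def)
    have "n \<notin> B"
      using block_unique[OF part B(1) \<open>{n} \<in> x\<close>, of n] B n by auto
    then show ?thesis using B n by (auto simp: PE_weight_def)
  qed
  then show ?thesis using fin by (simp add: prod_zero_iff)
qed

lemma refines_singletons_iff:
  "refines {1..n} x (singletons_partition n) \<longleftrightarrow> x = singletons_partition n"
proof -
  have part: "partition_on {1..n} (singletons_partition n)"
    unfolding singletons_partition_def by (rule partition_on_singletons)
  have "refines {1..n} (singletons_partition n) x" if "partition_on {1..n} x"
    using that part unfolding refines_def by (auto simp: singletons_partition_def partition_on_def)
  moreover have "partition_on {1..n} x" if "refines {1..n} x (singletons_partition n)"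
    using that by (simp add: refines_def)
  ultimately show ?thesis
    using refines_refl[OF part] refines_asym by metis
qed

lemma sum_PE_weight:
  assumes n: "n \<ge> 3" and z: "z \<in> PE n"
  shows "(\<Sum>x | x \<in> PE n \<and> (x, z) \<in> PE_dref n. \<Prod>B\<in>x. PE_weight n B) = of_bool (z = singletons_partition n)"
proof -
  have zNC: "z \<in> NC n" and part: "partition_on {1..n} z" using z by (auto simp: PE_def NC_def)
  have "finite {x. x \<in> NC n \<and> refines {1..n} x z}"
    by (rule finite_subset[OF _ finitely_many_partition_on[of "{1..n}"]]) (auto simp: refines_def)
  then have "(\<Sum>x | x \<in> PE n \<and> (x, z) \<in> PE_dref n. \<Prod>B\<in>x. PE_weight n B)
      = (\<Sum>x | x \<in> NC n \<and> refines {1..n} x z. \<Prod>B\<in>x. PE_weight n B)"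
    by (rule sum.mono_neutral_left)
      (use z prod_PE_weight_eq_0[OF n] in \<open>auto simp: PE_dref_def relation_of_def PE_def\<close>)
  also have "\<dots> = of_bool (z = singletons_partition n)"
  proof (cases "z = singletons_partition n")
    case True
    then have "{x. x \<in> NC n \<and> refines {1..n} x z} = {singletons_partition n}"
      using zNC by (auto simp only: refines_singletons_iff)
    moreover have "(\<Prod>B\<in>singletons_partition n. PE_weight n B) = 1"
      unfolding singletons_partition_def
      by (rule prod.neutral) (use n in \<open>auto simp: PE_weight_def\<close>)
    ultimately show ?thesis using True by simp
  next
    case False
    have "\<exists>D\<in>z. \<forall>e. D \<noteq> {e}"
    proof (rule ccontr)
      assume "\<not> ?thesis"
      then have "X \<in> singletons_partition n" if "X \<in> z" for X
        using partition_on_subset[OF part that] that by (auto simp: singletons_partition_def)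
      moreover have "partition_on {1..n} (singletons_partition n)"
        unfolding singletons_partition_def by (rule partition_on_singletons)
      ultimately have "refines {1..n} z (singletons_partition n)"
        using part unfolding refines_def by blast
      then show False using False by (simp only: refines_singletons_iff)
    qed
    then obtain D where D: "D \<in> z" "\<And>e. D \<noteq> {e}" by blast
    have Dn: "D \<subseteq> {1..n}" "D \<noteq> {}" using part D(1) by (auto simp: partition_on_def)
    have fin: "finite D" using Dn(1) finite_subset by blast
    have MM: "Min D \<in> D" "Max D \<in> D" "\<And>e. e \<in> D \<Longrightarrow> Min D \<le> e \<and> e \<le> Max D"
      using fin Dn(2) by auto
    have "Min D \<noteq> Max D"
    proof
      assume "Min D = Max D"
      then have "D = {Min D}" using MM by (auto intro: antisym)
      then show False using D(2) by blast
    qed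
    then have lt: "Min D < Max D" using MM by (meson order_le_less)
    have "(\<Sum>x | x \<in> NC n \<and> refines {1..n} x z. \<Prod>B\<in>x. PE_weight n B) = 0"
    proof (rule sum_refinements_eq_0[OF zNC D(1) MM lt])
      fix E assume E: "E \<subseteq> D" "Min D \<in> E" "Max D \<in> E"
      show "PE_weight n E + (\<Sum>t\<in>E - {Max D}. PE_weight n {e\<in>E. e \<le> t} * PE_weight n {e\<in>E. t < e}) = 0"
      proof (rule PE_weight_cancel[OF n _ E(2,3) _ lt])
        show "E \<subseteq> {1..n}" using E Dn by blast
        show "Min D \<le> e \<and> e \<le> Max D" if "e \<in> E" for e using MM(3) E(1) that by blast
        \<comment> \<open>Membership of \<open>z\<close> in \<open>PE n\<close> constrains
          \<open>D\<close>, not \<open>E\<close>. Since \<open>E\<close> contains the minimum of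
          \<open>D\<close>, this choice of \<open>E\<close> would force
          \<open>D = E\<close>.\<close>
        show "E \<noteq> {n - 1, n}"
        proof
          assume e: "E = {n - 1, n}"
          then have "Min D \<ge> n - 1" using E(2) by auto
          then have "\<And>e. e \<in> D \<Longrightarrow> e = n - 1 \<or> e = n" using MM(3) Dn(1) by fastforce
          then have "D = {n - 1, n}" using e E(1) by blast
          then show False using D(1) z by (simp add: PE_def)
        qed
        show "\<not> (1 \<in> E \<and> n - 1 \<in> E \<and> n \<notin> E)"
        proof
          assume e: "1 \<in> E \<and> n - 1 \<in> E \<and> n \<notin> E"
          then have "same_block z 1 (n - 1)" using D(1) E(1) by (auto simp: same_block_def)
          have "n \<notin> D"
          proof
            assume "n \<in> D"
            then have "Max D = n" using MM Dn(1) by (meson antisym atLeastAtMost_iff subsetD)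
            then show False using e E(3) by simp
          qed
          have "n \<in> \<Union> z"
            using n by (simp flip: partition_onD1[OF part])
          then obtain C where C: "C \<in> z" "n \<in> C" by blast
          have "C \<noteq> D" using C(2) \<open>n \<notin> D\<close> by blast
          \<comment> \<open>Any other \<open>j\<close> in the block of n would give the crossing 1 <
            j < n - 1 < n with \<open>D\<close>. So \<open>{n}\<close> is a block of
            \<open>z\<close>, the second pattern forbidden in \<open>PE n\<close>.\<close>
          have "j = n" if "j \<in> C" for j
          proof (rule ccontr)
            assume "j \<noteq> n"
            have "j \<notin> D" using block_unique[OF part C(1) D(1) that] \<open>C \<noteq> D\<close> by blast
            moreover have "1 \<in> D" "n - 1 \<in> D" using e E(1) by auto
            moreover have "1 \<le> j" "j \<le> n" using partition_on_subset[OF part C(1)] that by auto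
            ultimately have "j \<noteq> 1" "j \<noteq> n - 1" by metis+
            with \<open>1 \<le> j\<close> \<open>j \<le> n\<close> \<open>j \<noteq> n\<close> have "1 < j" "j < n - 1" "n - 1 < n" by auto
            from NC_D[OF zNC D(1) \<open>1 \<in> D\<close> \<open>n - 1 \<in> D\<close> C(1) that C(2) this] \<open>C \<noteq> D\<close>
            show False by simp
          qed
          then have "C = {n}" using C(2) by blast
          then show False using C(1) \<open>same_block z 1 (n - 1)\<close> z by (simp add: PE_def)
        qed
      qed
    qed
    then show ?thesis using False by simp
  qed
  finally show ?thesis .
qed

section \<open>Evaluation at the top element\<close>

theorem theorem1p4:
  fixes n :: nat
  assumes "n \<ge> 3"
  shows "real_of_int (mobius (PE n) (PE_dref n) (singletons_partition n) (one_block_partition n))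
       = (-1) ^ (n - 1) * (4 / real n) * real (choose_int (2 * n - 5) (int n - 4))"
proof -
  have "real_of_int (mobius (PE n) (PE_dref n) (singletons_partition n) (one_block_partition n))
      = (\<Prod>B\<in>one_block_partition n. PE_weight n B)"
    using assms
    by (intro mobius_top_eqI finite_poset_PE singletons_partition_in_PE one_block_partition_in_PE sum_PE_weight)
  also have "\<dots> = signed_catalan n + 2 * signed_catalan (n - 1)"
    using assms by (simp add: one_block_partition_def PE_weight_def)
  also have "\<dots> = (-1) ^ (n - 1) * (4 / real n) * real (choose_int (2 * n - 5) (int n - 4))"
    using assms by (rule signed_catalan_closed_form)
  finally show ?thesis .
qed

end
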